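(* Let $X\in\mathbb{R}^{n\times p}$, $Y\in\mathbb{R}^{n\times q}$ and $\lambda>0$. Consider the primal problem $$(P)\quad \min_{B\in\mathbb{R}^{p\times q},\,A\in\mathbb{R}^{n\times q}}\Big\{\lambda\|B\|_*+\tfrac12\|A\|_F^2\Big\}\quad\text{s.t.}\quad Y-XB-A=0,$$ and the dual problem (written as a minimization) $$(D)\quad \min_{C\in\mathbb{R}^{n\times q}}\Big\{\tfrac{\lambda^2}{2}\big\|C-\tfrac{Y}{\lambda}\big\|_F^2-\tfrac12\|Y\|_F^2\Big\}\quad\text{s.t.}\quad \|X^TC\|_2\le 1.$$ Then $(P)$ satisfies Slater's constraint qualification, and there exists a KKT point $(B^*(\lambda),A^*(\lambda),C^*(\lambda))$ of $(P)$ and $(D)$ such that $(B^*(\lambda),A^*(\lambda))$ is a solution of $(P)$, $C^*(\lambda)$ is a solution of $(D)$, and $$\lambda\|B^*(\lambda)\|_*+\tfrac12\|A^*(\lambda)\|_F^2=-\Big(\tfrac{\lambda^2}{2}\big\|C^*(\lambda)-\tfrac{Y}{\lambda}\big\|_F^2-\tfrac12\|Y\|_F^2\Big).$$ Moreover, $B^*(\lambda)$ is a solution of $\min_{B\in\mathbb{R}^{p\times q}}\{\tfrac12\|Y-XB\|_F^2+\lambda\|B\|_*\}$.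
   Context: $\|\cdot\|_F$, $\|\cdot\|_*$, $\|\cdot\|_2$ are the Frobenius, nuclear (sum of singular values) and spectral (largest singular value) norms of matrices. $\partial\|B\|_*$ is the convex subdifferential of the nuclear norm at $B$. A triple $(B,A,C)$ is a KKT point of $(P)$ and $(D)$ if $X^TC\in\partial\|B\|_*$, $A=\lambda C$, and $Y-XB-A=0$. Slater's constraint qualification for a convex problem with objective $f$ and feasible set $S$ given by linear constraints means $\mathrm{ri}(\mathrm{dom} f)\cap S\neq\emptyset$. *)

theory Defs
  imports "HOL-Analysis.Analysis"
begin

text \<open>
  An \<open>m \<times> n\<close> real matrix is an element of \<^typ>\<open>real^'n^'m\<close>. On this type the library's norm is
  the Frobenius norm and its inner product is the Frobenius (trace) inner product, so both are
  used directly.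
\<close>

lemma norm_matrix_frobenius:
  fixes A :: "real^'n^'m"
  shows "norm A = sqrt (\<Sum>i\<in>UNIV. \<Sum>j\<in>UNIV. (A $ i $ j)\<^sup>2)"
  by (simp add: norm_vec_def L2_set_def sum_nonneg)

lemma inner_matrix_frobenius:
  fixes A B :: "real^'n^'m"
  shows "A \<bullet> B = (\<Sum>i\<in>UNIV. \<Sum>j\<in>UNIV. A $ i $ j * B $ i $ j)"
  by (simp add: inner_vec_def)


section \<open>Singular values\<close>

definition singular_values :: "real^'n^'m \<Rightarrow> real set" where
  "singular_values A =
     {s. s \<ge> 0 \<and> (\<exists>v. v \<noteq> 0 \<and> (transpose A ** A) *v v = s\<^sup>2 *\<^sub>R v)}"

text \<open>
  \<open>A\<^sup>T A\<close> is symmetric, so the multiplicity of its eigenvalue \<open>s\<^sup>2\<close> is the dimension of the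
  eigenspace. For \<open>m < n\<close> this convention may count \<open>0\<close> more often than one with \<open>min m n\<close>
  singular values does; this affects neither their sum nor their maximum.
\<close>

definition singular_value_mult :: "real^'n^'m \<Rightarrow> real \<Rightarrow> nat" where
  "singular_value_mult A s = dim {v. (transpose A ** A) *v v = s\<^sup>2 *\<^sub>R v}"

definition nuclear_norm :: "real^'n^'m \<Rightarrow> real" where
  "nuclear_norm A = (\<Sum>s\<in>singular_values A. real (singular_value_mult A s) * s)"

definition spectral_norm :: "real^'n^'m \<Rightarrow> real" where
  "spectral_norm A = Max (singular_values A)"

text \<open>The set of singular values is finite and nonempty, so the sum and the maximum above are
  genuine.\<close>

lemma inner_gram:
  fixes A :: "real^'n^'m"
  shows "((transpose A ** A) *v v) \<bullet> w = (A *v v) \<bullet> (A *v w)"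
  by (metis dot_lmul_matrix inner_commute matrix_vector_mul_assoc transpose_matrix_vector)

lemma finite_singular_values:
  fixes A :: "real^'n^'m"
  shows "finite (singular_values A)"
proof -
  define f where
    "f s = (SOME v. v \<noteq> 0 \<and> (transpose A ** A) *v v = s\<^sup>2 *\<^sub>R v)" for s :: real
  have f: "f s \<noteq> 0" "(transpose A ** A) *v f s = s\<^sup>2 *\<^sub>R f s" if "s \<in> singular_values A" for s
    using that someI_ex[of "\<lambda>v. v \<noteq> 0 \<and> (transpose A ** A) *v v = s\<^sup>2 *\<^sub>R v"]
    by (auto simp: singular_values_def f_def)
  have orth: "f s \<bullet> f t = 0"
    if "s \<in> singular_values A" "t \<in> singular_values A" "s \<noteq> t" for s t
  proof -
    have "s\<^sup>2 * (f s \<bullet> f t) = t\<^sup>2 * (f s \<bullet> f t)"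
      using inner_gram[of A "f s" "f t"] inner_gram[of A "f t" "f s"] f that
      by (simp add: inner_commute)
    moreover have "s\<^sup>2 \<noteq> t\<^sup>2"
      using that by (auto simp: singular_values_def power2_eq_iff_nonneg)
    ultimately show ?thesis by simp
  qed
  have "inj_on f (singular_values A)"
  proof (rule inj_onI, rule ccontr)
    fix s t assume "s \<in> singular_values A" "t \<in> singular_values A" "f s = f t" "s \<noteq> t"
    then show False using orth[of s t] f(1)[of s] by simp
  qed
  moreover have "pairwise orthogonal (f ` singular_values A)"
    using orth by (auto simp: pairwise_def orthogonal_def)
  then have "finite (f ` singular_values A)"
    by (rule pairwise_orthogonal_imp_finite)
  ultimately show ?thesis using finite_imageD by blast
qed

lemma singular_values_nonempty:
  fixes A :: "real^'n^'m"
  shows "singular_values A \<noteq> {}"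
proof -
  have "continuous_on (sphere 0 1) (\<lambda>v. norm (A *v v))"
    by (intro continuous_intros linear_continuous_on) simp
  moreover have "sphere (0::real^'n) 1 \<noteq> {}" by simp
  ultimately obtain v where v: "norm v = 1"
    and mx: "\<And>w. norm w = 1 \<Longrightarrow> norm (A *v w) \<le> norm (A *v v)"
    using continuous_attains_sup[OF compact_sphere, of 0 1 "\<lambda>v. norm (A *v v)"] by auto
  define m where "m = norm (A *v v)"
  have bound: "norm (A *v w) \<le> m * norm w" for w
  proof (cases "w = 0")
    case False
    then have "norm (A *v ((1 / norm w) *\<^sub>R w)) \<le> m"
      unfolding m_def by (intro mx) simp
    then show ?thesis using False
      by (simp add: matrix_vector_mult_scaleR field_simps)
  qed simp
  define N where "N w = m\<^sup>2 * (w \<bullet> w) - (A *v w) \<bullet> (A *v w)" for w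
  have N0: "N w \<ge> 0" for w
    using power_mono[OF bound[of w], of 2] by (simp add: N_def power_mult_distrib power2_norm_eq_inner)
  have Nv: "N v = 0"
    using v by (simp add: N_def m_def power2_norm_eq_inner norm_eq_1)
  define u where "u = m\<^sup>2 *\<^sub>R v - (transpose A ** A) *v v"
  have vu: "m\<^sup>2 * (v \<bullet> u) - (A *v v) \<bullet> (A *v u) = u \<bullet> u"
  proof -
    have "u \<bullet> u = m\<^sup>2 * (v \<bullet> u) - ((transpose A ** A) *v v) \<bullet> u"
      by (subst (1) u_def) (simp add: inner_diff_left)
    then show ?thesis by (simp add: inner_gram)
  qed
  have "2 * (u \<bullet> u) \<le> s * N u" if "s > 0" for s
  proof -
    have "N (v - s *\<^sub>R u) = N v - 2 * s * (m\<^sup>2 * (v \<bullet> u) - (A *v v) \<bullet> (A *v u)) + s\<^sup>2 * N u"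
      by (simp add: N_def matrix_vector_mult_diff_distrib matrix_vector_mult_scaleR inner_diff_left
          inner_diff_right inner_commute power2_eq_square algebra_simps)
    then have "s * (2 * (u \<bullet> u)) \<le> s * (s * N u)"
      using N0[of "v - s *\<^sub>R u"] Nv vu by (simp add: power2_eq_square)
    then show ?thesis using that by simp
  qed
  note small = this
  have "u \<bullet> u \<le> 0"
  proof (rule ccontr)
    assume c: "\<not> u \<bullet> u \<le> 0"
    then have upos: "u \<bullet> u > 0" by linarith
    have Nu: "N u > 0" using small[of 1] upos by linarith
    have "2 * (u \<bullet> u) \<le> u \<bullet> u"
      using small[OF divide_pos_pos[OF upos Nu]] Nu by simp
    then show False using upos by linarith
  qed
  then have "u = 0" by (metis inner_ge_zero inner_eq_zero_iff order_antisym)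
  then have "(transpose A ** A) *v v = m\<^sup>2 *\<^sub>R v" by (simp add: u_def)
  moreover have "v \<noteq> 0" using v by auto
  moreover have "m \<ge> 0" by (simp add: m_def)
  ultimately show ?thesis by (auto simp: singular_values_def)
qed


section \<open>Convex analysis\<close>

definition subdifferential :: "('a::real_inner \<Rightarrow> real) \<Rightarrow> 'a \<Rightarrow> 'a set" where
  "subdifferential f x = {g. \<forall>y. f x + g \<bullet> (y - x) \<le> f y}"

definition effective_domain :: "('a \<Rightarrow> ereal) \<Rightarrow> 'a set" where
  "effective_domain f = {x. f x < \<infinity>}"

definition slater_cq :: "('a::euclidean_space \<Rightarrow> ereal) \<Rightarrow> 'a set \<Rightarrow> bool" where
  "slater_cq f S \<longleftrightarrow> rel_interior (effective_domain f) \<inter> S \<noteq> {}"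


section \<open>The primal and the dual problem\<close>

definition primal_obj :: "real \<Rightarrow> (real^'q^'p) \<times> (real^'q^'n) \<Rightarrow> real" where
  "primal_obj lam = (\<lambda>(B, A). lam * nuclear_norm B + 1/2 * (norm A)\<^sup>2)"

definition primal_feasible ::
    "real^'p^'n \<Rightarrow> real^'q^'n \<Rightarrow> ((real^'q^'p) \<times> (real^'q^'n)) set" where
  "primal_feasible X Y = {(B, A). Y - X ** B - A = 0}"

definition dual_obj :: "real \<Rightarrow> real^'q^'n \<Rightarrow> real^'q^'n \<Rightarrow> real" where
  "dual_obj lam Y C = lam\<^sup>2 / 2 * (norm (C - Y /\<^sub>R lam))\<^sup>2 - 1/2 * (norm Y)\<^sup>2"

definition dual_feasible :: "real^'p^'n \<Rightarrow> (real^'q^'n) set" where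
  "dual_feasible X = {C. spectral_norm (transpose X ** C) \<le> 1}"

definition kkt_point ::
    "real^'p^'n \<Rightarrow> real^'q^'n \<Rightarrow> real \<Rightarrow> real^'q^'p \<Rightarrow> real^'q^'n \<Rightarrow> real^'q^'n \<Rightarrow> bool" where
  "kkt_point X Y lam B A C \<longleftrightarrow>
     transpose X ** C \<in> subdifferential nuclear_norm B \<and> A = lam *\<^sub>R C \<and> Y - X ** B - A = 0"

end

theory Submission
  imports Defs
begin

text \<open>
  The nuclear norm is the support function of the unit ball of the spectral norm: this follows by
  expanding matrices along an orthonormal eigenbasis of \<open>B\<^sup>T B\<close>. Hence it is convex, continuous and
  coercive, so the regularized least squares problem has a minimizer \<open>B\<close>. Its first-order condition
  says that \<open>X\<^sup>T C\<close> with \<open>C = (Y - X B) / lam\<close> is a subgradient of the nuclear norm at \<open>B\<close>. A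
  subgradient \<open>G\<close> at \<open>B\<close> satisfies \<open>spectral_norm G \<le> 1\<close> and \<open>G \<bullet> B = nuclear_norm B\<close>, which makes
  \<open>C\<close> dual feasible and closes the duality gap.
\<close>

section \<open>Eigenvectors of the Gram matrix\<close>

text \<open>A maximizer of \<open>norm (A *v v)\<close> over the unit sphere of \<open>S\<close> is a critical point of the
  Rayleigh quotient.\<close>

lemma gram_eigenvector_in_invariant_subspace:
  fixes A :: "real^'n^'m"
  assumes S: "subspace S" "S \<noteq> {0}"
    and inv: "\<And>v. v \<in> S \<Longrightarrow> (transpose A ** A) *v v \<in> S"
  obtains v where "v \<in> S" "norm v = 1"
    "(transpose A ** A) *v v = (norm (A *v v))\<^sup>2 *\<^sub>R v"
proof -
  obtain x where x: "x \<in> S" "x \<noteq> 0"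
    using S subspace_0 by blast
  have "(1 / norm x) *\<^sub>R x \<in> sphere 0 1 \<inter> S"
    using x S(1) by (simp add: subspace_scale)
  then have "sphere 0 1 \<inter> S \<noteq> {}" by blast
  moreover have "compact (sphere 0 1 \<inter> S)"
    by (intro compact_Int_closed compact_sphere closed_subspace S)
  moreover have "continuous_on (sphere 0 1 \<inter> S) (\<lambda>v. norm (A *v v))"
    by (intro continuous_intros linear_continuous_on) simp
  ultimately obtain v where v: "norm v = 1" "v \<in> S"
    and mx: "\<And>w. norm w = 1 \<Longrightarrow> w \<in> S \<Longrightarrow> norm (A *v w) \<le> norm (A *v v)"
    using continuous_attains_sup[of "sphere 0 1 \<inter> S" "\<lambda>v. norm (A *v v)"]
    by (metis (no_types, lifting) Int_iff mem_sphere_0)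
  define m where "m = norm (A *v v)"
  have bound: "norm (A *v w) \<le> m * norm w" if "w \<in> S" for w
  proof (cases "w = 0")
    case False
    then have "norm (A *v ((1 / norm w) *\<^sub>R w)) \<le> m"
      unfolding m_def using that S by (intro mx) (auto simp: subspace_scale)
    then show ?thesis using False
      by (simp add: matrix_vector_mult_scaleR field_simps)
  qed simp
  \<comment> \<open>\<open>N\<close> is a quadratic form that is nonnegative on \<open>S\<close> and
    vanishes at \<open>v\<close>, so \<open>v\<close> minimizes it over \<open>S\<close>. The vector
    \<open>u\<close> below is half the gradient of \<open>N\<close> at \<open>v\<close>, and the
    claim amounts to \<open>u = 0\<close>.\<close>
  define N where "N w = m\<^sup>2 * (w \<bullet> w) - (A *v w) \<bullet> (A *v w)" for w
  have N0: "N w \<ge> 0" if "w \<in> S" for w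
    using power_mono[OF bound[OF that], of 2]
    by (simp add: N_def power_mult_distrib power2_norm_eq_inner)
  have Nv: "N v = 0"
    using v by (simp add: N_def m_def power2_norm_eq_inner norm_eq_1)
  define u where "u = m\<^sup>2 *\<^sub>R v - (transpose A ** A) *v v"
  have uS: "u \<in> S"
    unfolding u_def using v inv S by (intro subspace_diff subspace_scale)
  have vu: "m\<^sup>2 * (v \<bullet> u) - (A *v v) \<bullet> (A *v u) = u \<bullet> u"
  proof -
    have "u \<bullet> u = m\<^sup>2 * (v \<bullet> u) - ((transpose A ** A) *v v) \<bullet> u"
      by (subst (1) u_def) (simp add: inner_diff_left)
    then show ?thesis by (simp add: inner_gram)
  qed
  \<comment> \<open>A step of length \<open>s\<close> from \<open>v\<close> against the gradient
    stays in \<open>S\<close>. There \<open>N\<close> is still nonnegative, and dividing its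
    expansion by \<open>s\<close> gives a bound that forces \<open>u = 0\<close> as \<open>s\<close>
    tends to 0.\<close>
  have small: "2 * (u \<bullet> u) \<le> s * N u" if "s > 0" for s
  proof -
    have "N (v - s *\<^sub>R u) = N v - 2 * s * (m\<^sup>2 * (v \<bullet> u) - (A *v v) \<bullet> (A *v u)) + s\<^sup>2 * N u"
      by (simp add: N_def matrix_vector_mult_diff_distrib matrix_vector_mult_scaleR inner_diff_left
          inner_diff_right inner_commute power2_eq_square algebra_simps)
    moreover have "N (v - s *\<^sub>R u) \<ge> 0"
      using v uS S by (intro N0 subspace_diff subspace_scale)
    ultimately have "s * (2 * (u \<bullet> u)) \<le> s * (s * N u)"
      using Nv vu by (simp add: power2_eq_square)
    then show ?thesis using that by simp
  qed
  have "((\<lambda>s. s * N u) \<longlongrightarrow> 0 * N u) (at_right 0)"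
    by (intro tendsto_intros)
  moreover have "\<forall>\<^sub>F s in at_right 0. 2 * (u \<bullet> u) \<le> s * N u"
    using small eventually_at_right_less[of "0::real"] by (rule eventually_mono[rotated])
  ultimately have "2 * (u \<bullet> u) \<le> 0"
    using tendsto_lowerbound by fastforce
  then have "u = 0"
    by (metis inner_gt_zero_iff linorder_not_less mult_le_0_iff zero_less_numeral)
  then show thesis
    using that[of v] v by (simp add: u_def m_def)
qed

lemma orthogonal_gram_eigenvectors:
  fixes A :: "real^'n^'m"
  assumes "(transpose A ** A) *v v = a *\<^sub>R v" "(transpose A ** A) *v w = b *\<^sub>R w" "a \<noteq> b"
  shows "orthogonal v w"
proof -
  have "a * (v \<bullet> w) = b * (v \<bullet> w)"
    using inner_gram[of A v w] inner_gram[of A w v] assms by (simp add: inner_commute)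
  then show ?thesis using assms(3) by (simp add: orthogonal_def)
qed

text \<open>\<open>E\<close> is a basis of right singular vectors, the union of orthonormal bases of
  the eigenspaces of the Gram matrix. It turns the nuclear norm, defined through eigenvalues and
  multiplicities, into a sum over vectors.\<close>

lemma singular_basis_exists:
  fixes A :: "real^'n^'m"
  obtains E where "finite E" "pairwise orthogonal E" "\<And>b. b \<in> E \<Longrightarrow> norm b = 1" "span E = UNIV"
    "pairwise (\<lambda>b c. orthogonal (A *v b) (A *v c)) E"
    "\<And>b. b \<in> E \<Longrightarrow> norm (A *v b) \<in> singular_values A"
    "nuclear_norm A = (\<Sum>b\<in>E. norm (A *v b))"
proof -
  define V where "V s = {v. (transpose A ** A) *v v = s\<^sup>2 *\<^sub>R v}" for s :: real
  have V: "subspace (V s)" for s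
    by (auto simp: V_def subspace_def matrix_vector_right_distrib matrix_vector_mult_scaleR
        scaleR_right_distrib)
  have "\<exists>B. B \<subseteq> V s \<and> pairwise orthogonal B \<and> (\<forall>x\<in>B. norm x = 1) \<and> independent B
      \<and> card B = dim (V s) \<and> span B = V s" for s
    using orthonormal_basis_subspace[OF V[of s]] by metis
  then obtain F where F: "\<And>s. F s \<subseteq> V s" "\<And>s. pairwise orthogonal (F s)"
      "\<And>s x. x \<in> F s \<Longrightarrow> norm x = 1" "\<And>s. independent (F s)"
      "\<And>s. card (F s) = dim (V s)" "\<And>s. span (F s) = V s"
    by metis
  have finF: "finite (F s)" for s
    using F(4) by (rule independent_imp_finite)
  \<comment> \<open>The index \<open>s\<close> can be read off from \<open>b\<close>, so different
    singular values have disjoint bases and no multiplicity is lost in the union.\<close>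
  have norm_F: "norm (A *v b) = s" if "b \<in> F s" "s \<ge> 0" for b s
  proof -
    have "(transpose A ** A) *v b = s\<^sup>2 *\<^sub>R b"
      using F(1) that(1) by (auto simp: V_def)
    then have "(norm (A *v b))\<^sup>2 = s\<^sup>2 * (norm b)\<^sup>2"
      using inner_gram[of A b b] by (simp add: power2_norm_eq_inner)
    then show ?thesis using F(3)[OF that(1)] that(2) by simp
  qed
  define E where "E = (\<Union>s\<in>singular_values A. F s)"
  have sv0: "s \<ge> 0" if "s \<in> singular_values A" for s
    using that by (auto simp: singular_values_def)
  have eig: "(transpose A ** A) *v b = (norm (A *v b))\<^sup>2 *\<^sub>R b" if "b \<in> E" for b
    using that F(1) norm_F sv0 by (fastforce simp: E_def V_def)
  have finE: "finite E"
    using finF finite_singular_values by (auto simp: E_def)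
  have unit: "norm b = 1" if "b \<in> E" for b
    using that F(3) by (auto simp: E_def)
  have orth: "pairwise orthogonal E"
  proof (rule pairwiseI)
    fix b c assume bc: "b \<in> E" "c \<in> E" "b \<noteq> c"
    show "orthogonal b c"
    proof (cases "norm (A *v b) = norm (A *v c)")
      case True
      then have "\<exists>s. b \<in> F s \<and> c \<in> F s"
        using bc norm_F sv0 by (fastforce simp: E_def)
      then show ?thesis
        using F(2) bc(3) by (auto simp: pairwise_def)
    next
      case False
      then show ?thesis
        by (intro orthogonal_gram_eigenvectors[OF eig[OF bc(1)] eig[OF bc(2)]]) simp
    qed
  qed
  have orth': "pairwise (\<lambda>b c. orthogonal (A *v b) (A *v c)) E"
  proof (rule pairwiseI)
    fix b c assume bc: "b \<in> E" "c \<in> E" "b \<noteq> c"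
    have "(A *v b) \<bullet> (A *v c) = ((norm (A *v b))\<^sup>2 *\<^sub>R b) \<bullet> c"
      using inner_gram[of A b c] eig[OF bc(1)] by simp
    then show "orthogonal (A *v b) (A *v c)"
      using orth bc by (simp add: pairwise_def orthogonal_def)
  qed
  \<comment> \<open>The Gram matrix is self-adjoint, so the orthogonal complement of
    \<open>E\<close> is invariant. If it were nonzero it would contain an eigenvector, whose
    eigenspace is already spanned by part of \<open>E\<close>; this vector would be orthogonal to
    itself.\<close>
  have spanE: "span E = UNIV"
  proof (rule ccontr)
    assume "span E \<noteq> UNIV"
    define S where "S = orthogonal_comp E"
    have "dim E < DIM(real^'n)"
      using \<open>span E \<noteq> UNIV\<close> dim_eq_full[of E] dim_subset_UNIV[of E] by linarith
    then obtain x where "x \<noteq> 0" "\<And>y. y \<in> span E \<Longrightarrow> orthogonal x y"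
      using orthogonal_to_subspace_exists by blast
    then have "x \<in> S"
      by (auto simp: S_def orthogonal_comp_def orthogonal_commute span_base)
    with \<open>x \<noteq> 0\<close> have "S \<noteq> {0}" by blast
    have "subspace S"
      unfolding S_def by (rule subspace_orthogonal_comp)
    moreover note \<open>S \<noteq> {0}\<close>
    moreover have "(transpose A ** A) *v v \<in> S" if "v \<in> S" for v
    proof -
      have "b \<bullet> ((transpose A ** A) *v v) = 0" if b: "b \<in> E" for b
      proof -
        have "b \<bullet> ((transpose A ** A) *v v) = ((transpose A ** A) *v b) \<bullet> v"
          by (metis inner_gram inner_commute)
        also have "\<dots> = 0"
          using eig[OF b] b \<open>v \<in> S\<close> by (simp add: S_def orthogonal_comp_def orthogonal_def)
        finally show ?thesis .
      qed
      then show ?thesis by (simp add: S_def orthogonal_comp_def orthogonal_def)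
    qed
    ultimately obtain v where v: "v \<in> S" "norm v = 1"
        "(transpose A ** A) *v v = (norm (A *v v))\<^sup>2 *\<^sub>R v"
      by (rule gram_eigenvector_in_invariant_subspace)
    let ?s = "norm (A *v v)"
    have "v \<noteq> 0" using v(2) by auto
    then have "?s \<in> singular_values A"
      using v(3) by (auto simp: singular_values_def)
    then have "F ?s \<subseteq> E" by (auto simp: E_def)
    moreover have "v \<in> span (F ?s)" using v(3) by (simp add: F(6) V_def)
    ultimately have "v \<in> span E" using span_mono by blast
    then have "orthogonal v v"
      using v(1) by (intro orthogonal_to_span[of v E])
        (auto simp: S_def orthogonal_comp_def orthogonal_commute)
    then show False using \<open>v \<noteq> 0\<close> by (simp add: orthogonal_self)
  qed
  have sing: "norm (A *v b) \<in> singular_values A" if "b \<in> E" for b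
    using that norm_F sv0 by (fastforce simp: E_def)
  have "(\<Sum>b\<in>E. norm (A *v b)) = (\<Sum>s\<in>singular_values A. \<Sum>b\<in>F s. norm (A *v b))"
    unfolding E_def
  proof (rule sum.UNION_disjoint)
    show "\<forall>i\<in>singular_values A. \<forall>j\<in>singular_values A. i \<noteq> j \<longrightarrow> F i \<inter> F j = {}"
      using norm_F sv0 by (metis disjoint_iff)
  qed (use finF finite_singular_values in auto)
  also have "\<dots> = (\<Sum>s\<in>singular_values A. real (card (F s)) * s)"
    using norm_F sv0 by (intro sum.cong) auto
  also have "\<dots> = nuclear_norm A"
    by (simp add: nuclear_norm_def singular_value_mult_def F(5) V_def)
  finally have "nuclear_norm A = (\<Sum>b\<in>E. norm (A *v b))" by simp
  then show thesis using that[of E] finE unit orth orth' spanE sing by blast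
qed

section \<open>Duality of the nuclear and the spectral norm\<close>

lemma parseval_inner:
  fixes x y :: "'a::euclidean_space"
  assumes "finite E" "pairwise orthogonal E" "\<And>b. b \<in> E \<Longrightarrow> norm b = 1" "span E = UNIV"
  shows "x \<bullet> y = (\<Sum>b\<in>E. (x \<bullet> b) * (y \<bullet> b))"
proof -
  have "x \<bullet> y = (\<Sum>b\<in>E. (x \<bullet> b) *\<^sub>R b) \<bullet> y"
    using orthonormal_basis_expand[of E x] assms by simp
  also have "\<dots> = (\<Sum>b\<in>E. (x \<bullet> b) * (b \<bullet> y))"
    by (simp only: inner_sum_left inner_scaleR_left)
  finally show ?thesis by (simp add: inner_commute[of y])
qed

text \<open>Parseval applied to each row, followed by exchanging the two sums. It allows the trace
  inner product to be evaluated in a basis adapted to one of the matrices.\<close>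

lemma inner_matrix_orthonormal_basis:
  fixes G B :: "real^'n^'m"
  assumes "finite E" "pairwise orthogonal E" "\<And>b. b \<in> E \<Longrightarrow> norm b = 1" "span E = UNIV"
  shows "G \<bullet> B = (\<Sum>b\<in>E. (G *v b) \<bullet> (B *v b))"
proof -
  have "G \<bullet> B = (\<Sum>i\<in>UNIV. \<Sum>b\<in>E. (G $ i \<bullet> b) * (B $ i \<bullet> b))"
    by (simp add: inner_vec_def[of G B] flip: parseval_inner[OF assms])
  also have "\<dots> = (\<Sum>b\<in>E. (G *v b) \<bullet> (B *v b))"
    by (subst sum.swap) (simp add: inner_vec_def[of "_ *v _"] matrix_vector_mul_component)
  finally show ?thesis .
qed

lemma inner_transpose_matrix_mult:
  fixes X :: "real^'p^'n" and C :: "real^'q^'n" and B :: "real^'q^'p"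
  shows "(transpose X ** C) \<bullet> B = C \<bullet> (X ** B)"
proof -
  have E: "finite (Basis :: (real^'q) set)" "pairwise orthogonal (Basis :: (real^'q) set)"
      "\<And>b::real^'q. b \<in> Basis \<Longrightarrow> norm b = 1" "span (Basis :: (real^'q) set) = UNIV"
    by (auto simp: pairwise_def orthogonal_def inner_not_same_Basis)
  have "((transpose X ** C) *v b) \<bullet> (B *v b) = (C *v b) \<bullet> ((X ** B) *v b)" for b
    by (metis dot_lmul_matrix matrix_vector_mul_assoc transpose_matrix_vector)
  then show ?thesis by (simp add: inner_matrix_orthonormal_basis[OF E])
qed

text \<open>Forward, the images of a singular basis are orthogonal, so Pythagoras reduces the bound
  to the basis vectors. Backward, an eigenvector for \<open>s\<^sup>2\<close> is stretched by
  exactly \<open>s\<close>.\<close>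

lemma spectral_norm_le_1_iff:
  fixes A :: "real^'n^'m"
  shows "spectral_norm A \<le> 1 \<longleftrightarrow> (\<forall>v. norm (A *v v) \<le> norm v)"
proof
  assume "spectral_norm A \<le> 1"
  then have le1: "s \<le> 1" if "s \<in> singular_values A" for s
    using Max_ge[OF finite_singular_values that] by (simp add: spectral_norm_def)
  obtain E where E: "finite E" "pairwise orthogonal E" "\<And>b. b \<in> E \<Longrightarrow> norm b = 1" "span E = UNIV"
    "pairwise (\<lambda>b c. orthogonal (A *v b) (A *v c)) E"
    "\<And>b. b \<in> E \<Longrightarrow> norm (A *v b) \<in> singular_values A"
    using singular_basis_exists[of A] by metis
  show "\<forall>v. norm (A *v v) \<le> norm v"
  proof
    fix v
    have "A *v v = A *v (\<Sum>b\<in>E. (v \<bullet> b) *\<^sub>R b)"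
      using orthonormal_basis_expand[of E v] E by simp
    also have "\<dots> = (\<Sum>b\<in>E. (v \<bullet> b) *\<^sub>R (A *v b))"
      by (simp add: matrix_vector_mult_scaleR linear_sum)
    finally have Av: "A *v v = (\<Sum>b\<in>E. (v \<bullet> b) *\<^sub>R (A *v b))" .
    have "(norm (A *v v))\<^sup>2 = (\<Sum>b\<in>E. (norm ((v \<bullet> b) *\<^sub>R (A *v b)))\<^sup>2)"
      unfolding Av using E(1,5)
      by (intro norm_sum_Pythagorean) (auto simp: pairwise_def orthogonal_def)
    also have "\<dots> \<le> (\<Sum>b\<in>E. (v \<bullet> b)\<^sup>2)"
    proof (rule sum_mono)
      fix b assume "b \<in> E"
      then have "(norm (A *v b))\<^sup>2 \<le> 1"
        using le1 E(6) by (simp add: power_le_one)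
      then show "(norm ((v \<bullet> b) *\<^sub>R (A *v b)))\<^sup>2 \<le> (v \<bullet> b)\<^sup>2"
        by (simp add: power_mult_distrib mult_left_le)
    qed
    also have "\<dots> = (norm v)\<^sup>2"
      by (simp only: power2_norm_eq_inner parseval_inner[OF E(1-4), of v v])
        (simp only: power2_eq_square)
    finally show "norm (A *v v) \<le> norm v" by simp
  qed
next
  assume contr: "\<forall>v. norm (A *v v) \<le> norm v"
  have "s \<le> 1" if s: "s \<in> singular_values A" for s
  proof -
    obtain v where v: "v \<noteq> 0" "(transpose A ** A) *v v = s\<^sup>2 *\<^sub>R v" and "s \<ge> 0"
      using s by (auto simp: singular_values_def)
    have "s\<^sup>2 * (norm v)\<^sup>2 = (norm (A *v v))\<^sup>2"
      using inner_gram[of A v v] v(2) by (simp add: power2_norm_eq_inner)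
    also have "\<dots> \<le> (norm v)\<^sup>2" using contr by (simp add: power_mono)
    finally have "s\<^sup>2 \<le> 1" using v(1) by simp
    then show ?thesis using \<open>s \<ge> 0\<close> by (simp add: power2_le_iff_abs_le abs_square_le_1)
  qed
  then show "spectral_norm A \<le> 1"
    by (simp add: spectral_norm_def finite_singular_values singular_values_nonempty)
qed

text \<open>One half of the duality between the two norms: in a singular basis of \<open>B\<close>,
  apply Cauchy-Schwarz to each term and use that \<open>G\<close> is a contraction.\<close>

lemma inner_le_nuclear_norm:
  fixes G B :: "real^'n^'m"
  assumes "spectral_norm G \<le> 1"
  shows "G \<bullet> B \<le> nuclear_norm B"
proof -
  obtain E where E: "finite E" "pairwise orthogonal E" "\<And>b. b \<in> E \<Longrightarrow> norm b = 1" "span E = UNIV"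
    and nuc: "nuclear_norm B = (\<Sum>b\<in>E. norm (B *v b))"
    using singular_basis_exists[of B] by metis
  have "G \<bullet> B = (\<Sum>b\<in>E. (G *v b) \<bullet> (B *v b))"
    by (rule inner_matrix_orthonormal_basis[OF E])
  also have "\<dots> \<le> (\<Sum>b\<in>E. norm (B *v b))"
  proof (rule sum_mono)
    fix b assume "b \<in> E"
    then have "norm (G *v b) \<le> 1" using assms E(3) spectral_norm_le_1_iff by metis
    then show "(G *v b) \<bullet> (B *v b) \<le> norm (B *v b)"
      using norm_cauchy_schwarz[of "G *v b" "B *v b"]
      by (metis mult_right_mono mult_1 norm_ge_zero order_trans)
  qed
  finally show ?thesis by (simp add: nuc)
qed

text \<open>The other half of the duality. The witness is the partial isometry of the polar
  decomposition of \<open>B\<close>, which makes Cauchy-Schwarz tight on every vector of a singular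
  basis.\<close>

lemma nuclear_norm_attained:
  fixes B :: "real^'n^'m"
  obtains G where "spectral_norm G \<le> 1" "nuclear_norm B = G \<bullet> B"
proof -
  obtain E where E: "finite E" "pairwise orthogonal E" "\<And>b. b \<in> E \<Longrightarrow> norm b = 1" "span E = UNIV"
    and orth: "pairwise (\<lambda>b c. orthogonal (B *v b) (B *v c)) E"
    and nuc: "nuclear_norm B = (\<Sum>b\<in>E. norm (B *v b))"
    using singular_basis_exists[of B] by metis
  \<comment> \<open>\<open>g\<close> sends each basis vector \<open>b\<close> to the direction of
    \<open>B *v b\<close>. Since \<open>sgn 0 = 0\<close>, it vanishes on the kernel of
    \<open>B\<close>, and nonzero images remain orthonormal.\<close>
  define g where "g v = (\<Sum>b\<in>E. (v \<bullet> b) *\<^sub>R sgn (B *v b))" for v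
  have "linear g"
    by (rule linearI) (simp_all add: g_def inner_left_distrib scaleR_left_distrib sum.distrib
        scaleR_sum_right)
  then have G: "matrix g *v v = g v" for v by (metis matrix_vector_mul(2))
  have "norm (g v) \<le> norm v" for v
  proof -
    have "(norm (g v))\<^sup>2 = (\<Sum>b\<in>E. (norm ((v \<bullet> b) *\<^sub>R sgn (B *v b)))\<^sup>2)"
      unfolding g_def using E(1) orth
      by (intro norm_sum_Pythagorean) (auto simp: pairwise_def orthogonal_def sgn_div_norm)
    also have "\<dots> \<le> (\<Sum>b\<in>E. (v \<bullet> b)\<^sup>2)"
      by (rule sum_mono) (simp add: norm_sgn)
    also have "\<dots> = (norm v)\<^sup>2"
      by (simp only: power2_norm_eq_inner parseval_inner[OF E, of v v])
        (simp only: power2_eq_square)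
    finally show ?thesis by simp
  qed
  then have contr: "spectral_norm (matrix g) \<le> 1" by (simp add: spectral_norm_le_1_iff G)
  have "g b = sgn (B *v b)" if "b \<in> E" for b
  proof -
    have "g b = (\<Sum>c\<in>E. if c = b then sgn (B *v b) else 0)"
      unfolding g_def using that E(2,3)
      by (intro sum.cong) (auto simp: pairwise_def orthogonal_def norm_eq_1)
    then show ?thesis using that E(1) by simp
  qed
  moreover have "sgn x \<bullet> x = norm x" for x :: "real^'m"
    by (cases "x = 0") (auto simp: sgn_div_norm dot_square_norm power2_eq_square)
  ultimately have "nuclear_norm B = matrix g \<bullet> B"
    by (simp add: nuc inner_matrix_orthonormal_basis[OF E, of "matrix g" B] G)
  with contr show thesis by (rule that)
qed

section \<open>Norm properties and subgradients of the nuclear norm\<close>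

lemma nuclear_norm_0 [simp]: "nuclear_norm 0 = 0"
  by (metis inner_zero_right nuclear_norm_attained)

lemma nuclear_norm_triangle: "nuclear_norm (A + B) \<le> nuclear_norm A + nuclear_norm B"
  by (metis add_mono inner_le_nuclear_norm inner_right_distrib nuclear_norm_attained)

lemma convex_on_nuclear_norm: "convex_on UNIV nuclear_norm"
proof (rule convex_onI)
  fix t :: real and A B :: "real^'n^'m"
  assume t: "0 < t" "t < 1"
  obtain G where G: "spectral_norm G \<le> 1"
      "nuclear_norm ((1 - t) *\<^sub>R A + t *\<^sub>R B) = G \<bullet> ((1 - t) *\<^sub>R A + t *\<^sub>R B)"
    by (rule nuclear_norm_attained)
  show "nuclear_norm ((1 - t) *\<^sub>R A + t *\<^sub>R B) \<le> (1 - t) * nuclear_norm A + t * nuclear_norm B"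
    unfolding G(2) using t inner_le_nuclear_norm[OF G(1)]
    by (simp add: inner_right_distrib add_mono)
qed simp

text \<open>In a singular basis this compares the \<open>l2\<close> and \<open>l1\<close> norms of
  the singular values. It provides the coercivity behind the existence of a minimizer.\<close>

lemma norm_le_nuclear_norm: "norm B \<le> nuclear_norm B"
proof -
  obtain E where E: "finite E" "pairwise orthogonal E" "\<And>b. b \<in> E \<Longrightarrow> norm b = 1" "span E = UNIV"
    and nuc: "nuclear_norm B = (\<Sum>b\<in>E. norm (B *v b))"
    using singular_basis_exists[of B] by metis
  have "norm B = L2_set (\<lambda>b. norm (B *v b)) E"
    by (simp add: norm_eq_sqrt_inner[of B] L2_set_def power2_norm_eq_inner
        inner_matrix_orthonormal_basis[OF E, of B B])
  also have "\<dots> \<le> nuclear_norm B"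
    unfolding nuc by (rule L2_set_le_sum) simp
  finally show ?thesis .
qed

text \<open>The matrix is the outer product of \<open>u\<close> and \<open>v\<close>, and pairing it
  with \<open>G\<close> gives \<open>u \<bullet> (G *v v)\<close>. Such matrices serve to test how
  far a subgradient can stretch \<open>v\<close>.\<close>

lemma nuclear_norm_rank_one: "nuclear_norm (\<chi> i. u $ i *\<^sub>R v) \<le> norm u * norm v"
proof -
  obtain G where G: "spectral_norm G \<le> 1"
      "nuclear_norm (\<chi> i. u $ i *\<^sub>R v) = G \<bullet> (\<chi> i. u $ i *\<^sub>R v)"
    by (rule nuclear_norm_attained)
  have "G \<bullet> (\<chi> i. u $ i *\<^sub>R v) = u \<bullet> (G *v v)"
    by (simp add: inner_vec_def[of G] inner_vec_def[of u] matrix_vector_mul_component)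
  also have "\<dots> \<le> norm u * norm (G *v v)" by (rule norm_cauchy_schwarz)
  also have "\<dots> \<le> norm u * norm v"
    using G(1) by (simp add: spectral_norm_le_1_iff mult_left_mono)
  finally show ?thesis using G(2) by simp
qed

text \<open>The subgradient inequality at \<open>B + H\<close> together with the triangle inequality
  bounds \<open>G\<close> by the nuclear norm in every direction; at 0 it gives the reverse bound
  along \<open>B\<close>.\<close>

lemma subdifferential_nuclear_norm:
  assumes "G \<in> subdifferential nuclear_norm B"
  shows "spectral_norm G \<le> 1" "G \<bullet> B = nuclear_norm B"
proof -
  have sub: "nuclear_norm B + G \<bullet> (H - B) \<le> nuclear_norm H" for H
    using assms by (simp add: subdifferential_def)
  have dir: "G \<bullet> H \<le> nuclear_norm H" for H
    using sub[of "B + H"] nuclear_norm_triangle[of B H] by simp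
  have "nuclear_norm B \<le> G \<bullet> B"
    using sub[of 0] by simp
  then show "G \<bullet> B = nuclear_norm B" using dir[of B] by simp
  have "norm (G *v v) \<le> norm v" for v
  proof -
    \<comment> \<open>The direction is the outer product of \<open>G *v v\<close> with
      \<open>v\<close>, chosen so that its pairing with \<open>G\<close> is the squared length of
      \<open>G *v v\<close>.\<close>
    have "norm (G *v v) * norm (G *v v) = G \<bullet> (\<chi> i. (G *v v) $ i *\<^sub>R v)"
      by (simp add: inner_vec_def[of G] inner_vec_def[of "G *v v"] matrix_vector_mul_component
          flip: power2_eq_square dot_square_norm)
    also have "\<dots> \<le> norm (G *v v) * norm v"
      using dir nuclear_norm_rank_one order_trans by blast
    finally show ?thesis
      by (cases "G *v v = 0") auto
  qed
  then show "spectral_norm G \<le> 1" by (simp add: spectral_norm_le_1_iff)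
qed

section \<open>The regularized least squares problem\<close>

lemma regularized_minimizer_exists:
  fixes X :: "real^'p^'n" and Y :: "real^'q^'n"
  assumes "lam > 0"
  obtains B :: "real^'q^'p" where
    "\<And>B'. 1/2 * (norm (Y - X ** B))\<^sup>2 + lam * nuclear_norm B
       \<le> 1/2 * (norm (Y - X ** B'))\<^sup>2 + lam * nuclear_norm B'"
proof -
  define f where "f B = 1/2 * (norm (Y - X ** B))\<^sup>2 + lam * nuclear_norm B" for B :: "real^'q^'p"
  \<comment> \<open>Outside the ball of radius \<open>r\<close> the nuclear norm term alone already
    exceeds \<open>f 0\<close>, so a minimizer over this compact ball is global.\<close>
  define r where "r = f 0 / lam"
  have f0: "f 0 \<ge> 0" by (simp add: f_def)
  have "linear (\<lambda>B::real^'q^'p. X ** B)"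
    by (rule linearI) (simp_all add: matrix_add_ldistrib matrix_scalar_ac flip: scalar_matrix_assoc)
  then have "continuous_on (cball 0 r) (\<lambda>B::real^'q^'p. X ** B)"
    by (simp add: linear_continuous_on linear_conv_bounded_linear)
  moreover have "continuous_on (cball 0 r) (nuclear_norm :: real^'q^'p \<Rightarrow> real)"
    using convex_on_continuous[OF open_UNIV convex_on_nuclear_norm]
    by (rule continuous_on_subset) simp
  ultimately have "continuous_on (cball 0 r) f"
    unfolding f_def by (intro continuous_on_add continuous_on_mult continuous_on_const
        continuous_on_power continuous_on_norm continuous_on_diff)
  moreover have "r \<ge> 0" using f0 assms by (simp add: r_def)
  ultimately obtain B where B: "B \<in> cball 0 r" "\<And>B'. B' \<in> cball 0 r \<Longrightarrow> f B \<le> f B'"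
    using continuous_attains_inf[of "cball 0 r" f] by auto
  have "f B \<le> f B'" for B'
  proof (cases "B' \<in> cball 0 r")
    case False
    have "f B \<le> f 0" using B(2) \<open>r \<ge> 0\<close> by simp
    also have "f 0 \<le> lam * norm B'"
      using False assms by (simp add: r_def field_simps)
    also have "\<dots> \<le> lam * nuclear_norm B'"
      using assms norm_le_nuclear_norm by simp
    also have "\<dots> \<le> f B'" by (simp add: f_def)
    finally show ?thesis .
  qed (rule B(2))
  then show thesis using that unfolding f_def by blast
qed

text \<open>The first-order condition, derived directly: compare \<open>B\<close> with points on the
  segment towards \<open>H\<close>, bound the nuclear norm by convexity, expand the square, divide
  by \<open>t\<close> and let \<open>t\<close> tend to 0.\<close>

lemma regularized_minimizer_subgradient:
  fixes X :: "real^'p^'n" and Y :: "real^'q^'n"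
  assumes lam: "lam > 0"
    and min: "\<And>B'. 1/2 * (norm (Y - X ** B))\<^sup>2 + lam * nuclear_norm B
       \<le> 1/2 * (norm (Y - X ** B'))\<^sup>2 + lam * nuclear_norm B'"
  shows "transpose X ** ((Y - X ** B) /\<^sub>R lam) \<in> subdifferential nuclear_norm B"
proof -
  define A where "A = Y - X ** B"
  have "A \<bullet> (X ** (H - B)) \<le> lam * (nuclear_norm H - nuclear_norm B)" for H
  proof -
    define D where "D = X ** (H - B)"
    have key: "A \<bullet> D - t * (1/2 * (norm D)\<^sup>2) \<le> lam * (nuclear_norm H - nuclear_norm B)"
      if t: "0 < t" "t < 1" for t
    proof -
      have "nuclear_norm ((1 - t) *\<^sub>R B + t *\<^sub>R H) \<le> (1 - t) * nuclear_norm B + t * nuclear_norm H"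
        using convex_onD[OF convex_on_nuclear_norm, of t B H] t by simp
      then have "lam * nuclear_norm ((1 - t) *\<^sub>R B + t *\<^sub>R H)
          \<le> lam * ((1 - t) * nuclear_norm B + t * nuclear_norm H)"
        using lam by (intro mult_left_mono) auto
      moreover have "Y - X ** ((1 - t) *\<^sub>R B + t *\<^sub>R H) = A - t *\<^sub>R D"
      proof -
        have "(1 - t) *\<^sub>R B + t *\<^sub>R H = B + t *\<^sub>R (H - B)" by (simp add: algebra_simps)
        then show ?thesis
          by (simp add: A_def D_def matrix_add_ldistrib matrix_scalar_ac flip: scalar_matrix_assoc)
      qed
      then have "(norm (Y - X ** ((1 - t) *\<^sub>R B + t *\<^sub>R H)))\<^sup>2
          = (norm A)\<^sup>2 - 2 * t * (A \<bullet> D) + t\<^sup>2 * (norm D)\<^sup>2"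
        by (simp only: power2_norm_eq_inner)
          (simp add: inner_diff_left inner_diff_right inner_commute power2_eq_square)
      ultimately have "t * (A \<bullet> D - t * (1/2 * (norm D)\<^sup>2))
          \<le> t * (lam * (nuclear_norm H - nuclear_norm B))"
        using min[of "(1 - t) *\<^sub>R B + t *\<^sub>R H"]
        by (simp add: A_def[symmetric] algebra_simps power2_eq_square)
      then show ?thesis using t by simp
    qed
    have "((\<lambda>t. A \<bullet> D - t * (1/2 * (norm D)\<^sup>2)) \<longlongrightarrow> A \<bullet> D - 0 * (1/2 * (norm D)\<^sup>2)) (at_right 0)"
      by (intro tendsto_intros)
    moreover have "\<forall>\<^sub>F t in at_right 0. A \<bullet> D - t * (1/2 * (norm D)\<^sup>2)
        \<le> lam * (nuclear_norm H - nuclear_norm B)"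
      using key by (auto simp: eventually_at_right_field intro!: exI[of _ 1])
    ultimately show ?thesis
      unfolding D_def using tendsto_upperbound by fastforce
  qed
  then have "(A \<bullet> (X ** (H - B))) / lam \<le> nuclear_norm H - nuclear_norm B" for H
    using lam by (simp add: field_simps)
  then show ?thesis
    by (simp add: subdifferential_def inner_transpose_matrix_mult divide_inverse_commute
        le_diff_eq add.commute flip: A_def)
qed

section \<open>Weak and strong duality\<close>

lemma dual_obj_eq:
  assumes "lam \<noteq> 0"
  shows "dual_obj lam Y C = lam\<^sup>2 / 2 * (norm C)\<^sup>2 - lam * (C \<bullet> Y)"
proof -
  have "lam\<^sup>2 * (norm (C - Y /\<^sub>R lam))\<^sup>2 = (norm (lam *\<^sub>R (C - Y /\<^sub>R lam)))\<^sup>2"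
    by (simp add: power_mult_distrib)
  also have "lam *\<^sub>R (C - Y /\<^sub>R lam) = lam *\<^sub>R C - Y"
    using assms by (simp add: scaleR_diff_right)
  also have "(norm (lam *\<^sub>R C - Y))\<^sup>2 = lam\<^sup>2 * (norm C)\<^sup>2 - 2 * lam * (C \<bullet> Y) + (norm Y)\<^sup>2"
    by (simp only: power2_norm_eq_inner)
      (simp add: inner_diff_left inner_diff_right inner_commute power2_eq_square)
  finally show ?thesis by (simp add: dual_obj_def algebra_simps)
qed

text \<open>Feasibility splits \<open>C \<bullet> Y\<close> into a part paired with
  \<open>X ** B\<close>, bounded by norm duality, and a part paired with \<open>A\<close>, bounded
  by expanding the square of \<open>A - lam *\<^sub>R C\<close>.\<close>

lemma weak_duality:
  assumes lam: "lam > 0" and BA: "(B, A) \<in> primal_feasible X Y" and C: "C \<in> dual_feasible X"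
  shows "- dual_obj lam Y C \<le> primal_obj lam (B, A)"
proof -
  have "(transpose X ** C) \<bullet> B \<le> nuclear_norm B"
    using C by (intro inner_le_nuclear_norm) (simp add: dual_feasible_def)
  then have 1: "lam * (C \<bullet> (X ** B)) \<le> lam * nuclear_norm B"
    using lam by (simp add: inner_transpose_matrix_mult)
  have "0 \<le> (norm (A - lam *\<^sub>R C))\<^sup>2" by simp
  then have 2: "lam * (C \<bullet> A) - lam\<^sup>2 / 2 * (norm C)\<^sup>2 \<le> 1/2 * (norm A)\<^sup>2"
    by (simp only: power2_norm_eq_inner)
      (simp add: inner_diff_left inner_diff_right inner_commute power2_eq_square)
  have "Y = X ** B + A" using BA by (simp add: primal_feasible_def algebra_simps)
  then have 3: "lam * (C \<bullet> Y) = lam * (C \<bullet> (X ** B)) + lam * (C \<bullet> A)"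
    by (simp add: inner_right_distrib distrib_left)
  have "- dual_obj lam Y C = lam * (C \<bullet> Y) - lam\<^sup>2 / 2 * (norm C)\<^sup>2"
    using lam by (simp add: dual_obj_eq)
  also have "\<dots> \<le> lam * nuclear_norm B + 1/2 * (norm A)\<^sup>2"
    using 1 2 3 by linarith
  finally show ?thesis by (simp add: primal_obj_def)
qed

lemma kkt_point_dual_feasible:
  "kkt_point X Y lam B A C \<Longrightarrow> C \<in> dual_feasible X"
  using subdifferential_nuclear_norm(1) by (auto simp: kkt_point_def dual_feasible_def)

text \<open>Both inequalities of weak duality become equalities: the subgradient attains the nuclear
  norm at \<open>B\<close>, and \<open>A - lam *\<^sub>R C\<close> vanishes.\<close>

lemma kkt_point_strong_duality:
  assumes lam: "lam > 0" and kkt: "kkt_point X Y lam B A C"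
  shows "primal_obj lam (B, A) = - dual_obj lam Y C"
proof -
  have "nuclear_norm B = C \<bullet> (X ** B)"
    using kkt subdifferential_nuclear_norm(2) inner_transpose_matrix_mult
    by (metis kkt_point_def)
  moreover have "A = lam *\<^sub>R C" "Y = X ** B + lam *\<^sub>R C"
    using kkt by (auto simp: kkt_point_def algebra_simps)
  ultimately show ?thesis
    using lam by (simp add: dual_obj_eq primal_obj_def inner_right_distrib dot_square_norm
        power_mult_distrib algebra_simps power2_eq_square)
qed

theorem theorem2p1:
  fixes X :: "real^'p^'n" and Y :: "real^'q^'n" and lam :: real
  assumes "lam > 0"
  shows "slater_cq (\<lambda>z :: (real^'q^'p) \<times> (real^'q^'n). ereal (primal_obj lam z)) (primal_feasible X Y) \<and>
    (\<exists>B A C. kkt_point X Y lam B A C \<and>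
       is_arg_min (primal_obj lam) (\<lambda>z. z \<in> primal_feasible X Y) (B, A) \<and>
       is_arg_min (dual_obj lam Y) (\<lambda>C. C \<in> dual_feasible X) C \<and>
       lam * nuclear_norm B + 1/2 * (norm A)\<^sup>2
         = - (lam\<^sup>2 / 2 * (norm (C - Y /\<^sub>R lam))\<^sup>2 - 1/2 * (norm Y)\<^sup>2) \<and>
       is_arg_min (\<lambda>B. 1/2 * (norm (Y - X ** B))\<^sup>2 + lam * nuclear_norm B) (\<lambda>_. True) B)"
proof
  \<comment> \<open>The primal objective is finite everywhere, so its effective domain is the whole
    space and any feasible point witnesses Slater's condition.\<close>
  have "(0, Y) \<in> primal_feasible X Y" by (simp add: primal_feasible_def)
  then show "slater_cq (\<lambda>z :: (real^'q^'p) \<times> (real^'q^'n). ereal (primal_obj lam z))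
      (primal_feasible X Y)"
    by (auto simp: slater_cq_def effective_domain_def)
next
  obtain B where min: "\<And>B'. 1/2 * (norm (Y - X ** B))\<^sup>2 + lam * nuclear_norm B
       \<le> 1/2 * (norm (Y - X ** B'))\<^sup>2 + lam * nuclear_norm B'"
    using regularized_minimizer_exists[OF assms] by blast
  \<comment> \<open>Given \<open>B\<close>, the KKT equations determine \<open>A\<close> as the
    residual and \<open>C\<close> as the residual divided by \<open>lam\<close>.\<close>
  define A where "A = Y - X ** B"
  define C where "C = A /\<^sub>R lam"
  have kkt: "kkt_point X Y lam B A C"
    using regularized_minimizer_subgradient[OF assms min] assms
    by (simp add: kkt_point_def A_def C_def)
  have strong: "primal_obj lam (B, A) = - dual_obj lam Y C"
    using assms kkt by (rule kkt_point_strong_duality)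
  have BA: "(B, A) \<in> primal_feasible X Y" by (simp add: primal_feasible_def A_def)
  have C: "C \<in> dual_feasible X" using kkt by (rule kkt_point_dual_feasible)
  \<comment> \<open>With a zero duality gap, each of \<open>(B, A)\<close> and \<open>C\<close>
    certifies the optimality of the other through weak duality.\<close>
  have "is_arg_min (primal_obj lam) (\<lambda>z. z \<in> primal_feasible X Y) (B, A)"
    using weak_duality[OF assms _ C] BA strong by (auto simp: is_arg_min_linorder)
  moreover have "is_arg_min (dual_obj lam Y) (\<lambda>C. C \<in> dual_feasible X) C"
    using weak_duality[OF assms BA] C strong by (fastforce simp: is_arg_min_linorder)
  moreover have "is_arg_min (\<lambda>B. 1/2 * (norm (Y - X ** B))\<^sup>2 + lam * nuclear_norm B) (\<lambda>_. True) B"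
    using min by (simp add: is_arg_min_linorder)
  moreover have "lam * nuclear_norm B + 1/2 * (norm A)\<^sup>2
      = - (lam\<^sup>2 / 2 * (norm (C - Y /\<^sub>R lam))\<^sup>2 - 1/2 * (norm Y)\<^sup>2)"
    using strong by (simp add: primal_obj_def dual_obj_def)
  ultimately show "\<exists>B A C. kkt_point X Y lam B A C \<and>
       is_arg_min (primal_obj lam) (\<lambda>z. z \<in> primal_feasible X Y) (B, A) \<and>
       is_arg_min (dual_obj lam Y) (\<lambda>C. C \<in> dual_feasible X) C \<and>
       lam * nuclear_norm B + 1/2 * (norm A)\<^sup>2
         = - (lam\<^sup>2 / 2 * (norm (C - Y /\<^sub>R lam))\<^sup>2 - 1/2 * (norm Y)\<^sup>2) \<and>
       is_arg_min (\<lambda>B. 1/2 * (norm (Y - X ** B))\<^sup>2 + lam * nuclear_norm B) (\<lambda>_. True) B"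
    using kkt by blast
qed

end
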